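(* Let $S$ be a left I-order in a primitive inverse semigroup $Q$, let $T$ be a left I-order in a primitive inverse semigroup $P$, and let $\phi:S\rightarrow T$ be an isomorphism. Then $\phi$ lifts to an isomorphism $\overline{\phi}:Q\rightarrow P$, i.e. there is an isomorphism $\overline{\phi}:Q\to P$ with $\overline{\phi}|_S=\phi$.
   Context: An inverse semigroup $Q$ with zero is primitive if every nonzero idempotent $e$ of $Q$ is primitive, i.e. for every idempotent $f$, $f\le e$ (that is, $ef=fe=f$) implies $f=0$ or $f=e$. A subsemigroup $S$ of an inverse semigroup $Q$ is a left I-order in $Q$ if every $q\in Q$ can be written as $q=a^{-1}b$ with $a,b\in S$, where $a^{-1}$ is the inverse of $a$ in the inverse semigroup $Q$. *)

theory Defs
  imports "HOL-Algebra.Group"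
begin

(* Semigroups are carried by the monoid record of HOL-Algebra, so that its multiplication, hom
   and iso (which mention only carrier and multiplication) can be used; the field for the unit is
   left unconstrained and plays no role. In particular the group inverse m_inv, which refers
   to the unit, is not used. *)

locale inverse_semigroup =
  fixes Q :: "('a, 'b) monoid_scheme" (structure)
  assumes mult_closed: "\<lbrakk>x \<in> carrier Q; y \<in> carrier Q\<rbrakk> \<Longrightarrow> x \<otimes> y \<in> carrier Q"
    and mult_assoc: "\<lbrakk>x \<in> carrier Q; y \<in> carrier Q; z \<in> carrier Q\<rbrakk>
      \<Longrightarrow> (x \<otimes> y) \<otimes> z = x \<otimes> (y \<otimes> z)"
    and ex1_inverse: "x \<in> carrier Q
      \<Longrightarrow> \<exists>!y. y \<in> carrier Q \<and> x \<otimes> y \<otimes> x = x \<and> y \<otimes> x \<otimes> y = y"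

definition sg_inv :: "('a, 'b) monoid_scheme \<Rightarrow> 'a \<Rightarrow> 'a" where
  "sg_inv Q x = (THE y. y \<in> carrier Q \<and> x \<otimes>\<^bsub>Q\<^esub> y \<otimes>\<^bsub>Q\<^esub> x = x \<and> y \<otimes>\<^bsub>Q\<^esub> x \<otimes>\<^bsub>Q\<^esub> y = y)"

definition is_zero :: "('a, 'b) monoid_scheme \<Rightarrow> 'a \<Rightarrow> bool" where
  "is_zero Q z \<longleftrightarrow> z \<in> carrier Q \<and> (\<forall>x\<in>carrier Q. z \<otimes>\<^bsub>Q\<^esub> x = z \<and> x \<otimes>\<^bsub>Q\<^esub> z = z)"

definition idempotents :: "('a, 'b) monoid_scheme \<Rightarrow> 'a set" where
  "idempotents Q = {e \<in> carrier Q. e \<otimes>\<^bsub>Q\<^esub> e = e}"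

definition idem_le :: "('a, 'b) monoid_scheme \<Rightarrow> 'a \<Rightarrow> 'a \<Rightarrow> bool" where
  "idem_le Q f e \<longleftrightarrow> e \<otimes>\<^bsub>Q\<^esub> f = f \<and> f \<otimes>\<^bsub>Q\<^esub> e = f"

definition primitive_idempotent :: "('a, 'b) monoid_scheme \<Rightarrow> 'a \<Rightarrow> bool" where
  "primitive_idempotent Q e \<longleftrightarrow> e \<in> idempotents Q \<and> \<not> is_zero Q e \<and>
     (\<forall>f\<in>idempotents Q. idem_le Q f e \<longrightarrow> is_zero Q f \<or> f = e)"

locale primitive_inverse_semigroup = inverse_semigroup +
  assumes ex_zero: "\<exists>z. is_zero Q z"
    and primitive: "\<lbrakk>e \<in> idempotents Q; \<not> is_zero Q e\<rbrakk> \<Longrightarrow> primitive_idempotent Q e"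

definition subsemigroup :: "'a set \<Rightarrow> ('a, 'b) monoid_scheme \<Rightarrow> bool" where
  "subsemigroup S Q \<longleftrightarrow> S \<subseteq> carrier Q \<and> S \<noteq> {} \<and> (\<forall>a\<in>S. \<forall>b\<in>S. a \<otimes>\<^bsub>Q\<^esub> b \<in> S)"

definition left_I_order :: "'a set \<Rightarrow> ('a, 'b) monoid_scheme \<Rightarrow> bool" where
  "left_I_order S Q \<longleftrightarrow> subsemigroup S Q \<and>
     (\<forall>q\<in>carrier Q. \<exists>a\<in>S. \<exists>b\<in>S. q = sg_inv Q a \<otimes>\<^bsub>Q\<^esub> b)"

end

theory Submission
  imports Defs
begin

text \<open>
  In a primitive inverse semigroup a product of nonzero elements \<open>x y\<close> is nonzero exactly when
  \<open>x\<^sup>-\<^sup>1 x = y y\<^sup>-\<^sup>1\<close>. Consequently everything about quotients of elements of a left I-order \<open>S\<close> can be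
  read off inside \<open>S\<close>: the zero lies in \<open>S\<close>; \<open>a\<^sup>-\<^sup>1 b \<noteq> 0\<close> iff \<open>x a\<close> and \<open>x b\<close> are nonzero for a common
  \<open>x \<in> S\<close>; nonzero quotients satisfy \<open>a\<^sup>-\<^sup>1 b = c\<^sup>-\<^sup>1 d\<close> iff \<open>x a = y c \<noteq> 0\<close> and \<open>x b = y d\<close> for some
  \<open>x, y \<in> S\<close>; and \<open>(a\<^sup>-\<^sup>1 b) (c\<^sup>-\<^sup>1 d)\<close> is nonzero iff \<open>x b = y c \<noteq> 0\<close> for some \<open>x, y \<in> S\<close>, in which
  case it equals \<open>(x a)\<^sup>-\<^sup>1 (y d)\<close>. Hence \<open>a\<^sup>-\<^sup>1 b \<mapsto> \<phi>(a)\<^sup>-\<^sup>1 \<phi>(b)\<close> is a well-defined isomorphism.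
\<close>

section \<open>Inverse semigroups: commuting idempotents and inverses of products\<close>

context inverse_semigroup
begin

abbreviation inverse_of :: "'a \<Rightarrow> 'a"  ("_\<^sup>\<dagger>" [999] 999)
  where "x\<^sup>\<dagger> \<equiv> sg_inv Q x"

lemma inverse_of_props:
  assumes "x \<in> carrier Q"
  shows "x\<^sup>\<dagger> \<in> carrier Q \<and> x \<otimes> x\<^sup>\<dagger> \<otimes> x = x \<and> x\<^sup>\<dagger> \<otimes> x \<otimes> x\<^sup>\<dagger> = x\<^sup>\<dagger>"
  unfolding sg_inv_def by (rule theI'[OF ex1_inverse[OF assms]])

lemma inverse_closed: "x \<in> carrier Q \<Longrightarrow> x\<^sup>\<dagger> \<in> carrier Q"
  using inverse_of_props by blast

lemmas closed = mult_closed inverse_closed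

lemma mult_inverse_mult: "x \<in> carrier Q \<Longrightarrow> x \<otimes> (x\<^sup>\<dagger> \<otimes> x) = x"
  using inverse_of_props mult_assoc by metis

lemma inverse_mult_inverse: "x \<in> carrier Q \<Longrightarrow> x\<^sup>\<dagger> \<otimes> (x \<otimes> x\<^sup>\<dagger>) = x\<^sup>\<dagger>"
  using inverse_of_props mult_assoc by metis

lemma mult_inverse_mult_left:
  "\<lbrakk>x \<in> carrier Q; y \<in> carrier Q\<rbrakk> \<Longrightarrow> x \<otimes> (x\<^sup>\<dagger> \<otimes> (x \<otimes> y)) = x \<otimes> y"
  by (metis closed mult_assoc mult_inverse_mult)

lemma inverse_mult_inverse_left:
  "\<lbrakk>x \<in> carrier Q; y \<in> carrier Q\<rbrakk> \<Longrightarrow> x\<^sup>\<dagger> \<otimes> (x \<otimes> (x\<^sup>\<dagger> \<otimes> y)) = x\<^sup>\<dagger> \<otimes> y"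
  by (metis closed mult_assoc inverse_mult_inverse)

lemmas inverse_simps = closed mult_assoc mult_inverse_mult inverse_mult_inverse
  mult_inverse_mult_left inverse_mult_inverse_left

lemma inverse_eqI:
  assumes "x \<in> carrier Q" "y \<in> carrier Q" "x \<otimes> (y \<otimes> x) = x" "y \<otimes> (x \<otimes> y) = y"
  shows "x\<^sup>\<dagger> = y"
  using ex1_inverse[OF assms(1)] inverse_of_props[OF assms(1)] assms mult_assoc by metis

lemma inverse_inverse: "x \<in> carrier Q \<Longrightarrow> x\<^sup>\<dagger>\<^sup>\<dagger> = x"
  by (rule inverse_eqI) (simp_all add: inverse_simps)

text \<open>With \<open>a\<close> the inverse of \<open>e \<otimes> f\<close>, the product
  \<open>f \<otimes> (a \<otimes> e)\<close> is an inverse too, so it equals \<open>a\<close> by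
  uniqueness. This makes \<open>a\<close> idempotent, hence its own inverse, and so \<open>a\<close>
  is \<open>e \<otimes> f\<close> itself.\<close>

lemma idempotents_mult:
  assumes "e \<in> idempotents Q" "f \<in> idempotents Q"
  shows "e \<otimes> f \<in> idempotents Q"
proof -
  have e: "e \<in> carrier Q" "e \<otimes> e = e" and f: "f \<in> carrier Q" "f \<otimes> f = f"
    using assms by (auto simp: idempotents_def)
  have e': "e \<otimes> (e \<otimes> u) = e \<otimes> u" and f': "f \<otimes> (f \<otimes> u) = f \<otimes> u" if "u \<in> carrier Q" for u
    using e f that by (metis mult_assoc)+
  define a where "a = (e \<otimes> f)\<^sup>\<dagger>"
  have a: "a \<in> carrier Q" by (simp add: a_def closed e f)
  have a1: "e \<otimes> (f \<otimes> (a \<otimes> (e \<otimes> f))) = e \<otimes> f"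
    using mult_inverse_mult[of "e \<otimes> f"] a e f by (simp add: a_def[symmetric] closed mult_assoc)
  have a2: "a \<otimes> (e \<otimes> (f \<otimes> a)) = a"
    using inverse_mult_inverse[of "e \<otimes> f"] a e f by (simp add: a_def[symmetric] closed mult_assoc)
  have a2': "a \<otimes> (e \<otimes> (f \<otimes> (a \<otimes> u))) = a \<otimes> u" if "u \<in> carrier Q" for u
    using arg_cong[OF a2, of "\<lambda>v. v \<otimes> u"] a e f that by (simp add: closed mult_assoc)
  have "a = f \<otimes> (a \<otimes> e)" unfolding a_def
    by (rule inverse_eqI)
      (use a e f a1 a2 in \<open>simp_all add: a_def[symmetric] closed mult_assoc e' f' a2'\<close>)
  \<comment> \<open>Substituting \<open>a = f a e\<close> twice leaves \<open>f (a e f a) e\<close>,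
    where the bracket collapses to \<open>a\<close> by \<open>a2\<close>.\<close>
  then have "a \<otimes> a = a"
    using a e f a2' by (metis closed mult_assoc)
  then have "a\<^sup>\<dagger> = a" by (intro inverse_eqI) (simp_all add: a)
  moreover have "a\<^sup>\<dagger> = e \<otimes> f" by (simp add: a_def inverse_inverse closed e f)
  ultimately show ?thesis using \<open>a \<otimes> a = a\<close> a by (simp add: idempotents_def)
qed

text \<open>Both \<open>e \<otimes> f\<close> and \<open>f \<otimes> e\<close> are inverses of
  \<open>e \<otimes> f\<close>, since products of idempotents are idempotent; uniqueness identifies
  them.\<close>

lemma idempotents_commute:
  assumes "e \<in> idempotents Q" "f \<in> idempotents Q"
  shows "e \<otimes> f = f \<otimes> e"
proof -
  have e: "e \<in> carrier Q" "e \<otimes> e = e" and f: "f \<in> carrier Q" "f \<otimes> f = f"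
    using assms by (auto simp: idempotents_def)
  have e': "e \<otimes> (e \<otimes> u) = e \<otimes> u" and f': "f \<otimes> (f \<otimes> u) = f \<otimes> u" if "u \<in> carrier Q" for u
    using e f that by (metis mult_assoc)+
  have ef: "e \<otimes> (f \<otimes> (e \<otimes> f)) = e \<otimes> f" "f \<otimes> (e \<otimes> (f \<otimes> e)) = f \<otimes> e"
    using idempotents_mult[OF assms] idempotents_mult[OF assms(2,1)] e f
    by (simp_all add: idempotents_def mult_assoc closed)
  have "(e \<otimes> f)\<^sup>\<dagger> = e \<otimes> f"
    by (rule inverse_eqI) (use e f ef in \<open>simp_all add: closed mult_assoc\<close>)
  moreover have "(e \<otimes> f)\<^sup>\<dagger> = f \<otimes> e"
    by (rule inverse_eqI) (use e f ef in \<open>simp_all add: closed mult_assoc e' f'\<close>)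
  ultimately show ?thesis by simp
qed

lemma mult_inverse_idempotent: "x \<in> carrier Q \<Longrightarrow> x \<otimes> x\<^sup>\<dagger> \<in> idempotents Q"
  and inverse_mult_idempotent: "x \<in> carrier Q \<Longrightarrow> x\<^sup>\<dagger> \<otimes> x \<in> idempotents Q"
  by (simp_all add: idempotents_def inverse_simps)

text \<open>The idempotents \<open>y y^-1\<close> and \<open>x^-1 x\<close> commute, which brings
  each element next to its own inverse in the two defining equations.\<close>

lemma inverse_mult:
  assumes "x \<in> carrier Q" "y \<in> carrier Q"
  shows "(x \<otimes> y)\<^sup>\<dagger> = y\<^sup>\<dagger> \<otimes> x\<^sup>\<dagger>"
proof (rule inverse_eqI)
  have comm: "(y \<otimes> y\<^sup>\<dagger>) \<otimes> (x\<^sup>\<dagger> \<otimes> x) = (x\<^sup>\<dagger> \<otimes> x) \<otimes> (y \<otimes> y\<^sup>\<dagger>)"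
    by (intro idempotents_commute mult_inverse_idempotent inverse_mult_idempotent assms)
  have c: "y \<otimes> (y\<^sup>\<dagger> \<otimes> (x\<^sup>\<dagger> \<otimes> (x \<otimes> u))) = x\<^sup>\<dagger> \<otimes> (x \<otimes> (y \<otimes> (y\<^sup>\<dagger> \<otimes> u)))"
    if "u \<in> carrier Q" for u
    using arg_cong[OF comm, of "\<lambda>v. v \<otimes> u"] assms that by (simp add: closed mult_assoc)
  show "x \<otimes> y \<otimes> (y\<^sup>\<dagger> \<otimes> x\<^sup>\<dagger> \<otimes> (x \<otimes> y)) = x \<otimes> y"
    using c[of y] assms by (simp add: inverse_simps)
  show "y\<^sup>\<dagger> \<otimes> x\<^sup>\<dagger> \<otimes> (x \<otimes> y \<otimes> (y\<^sup>\<dagger> \<otimes> x\<^sup>\<dagger>)) = y\<^sup>\<dagger> \<otimes> x\<^sup>\<dagger>"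
    using c[of "x\<^sup>\<dagger>", symmetric] assms by (simp add: inverse_simps)
qed (simp_all add: closed assms)

end

section \<open>Nonzero products in a primitive inverse semigroup with a named zero\<close>

locale primitive_left_I_order = primitive_inverse_semigroup +
  fixes S :: "'a set" and z :: 'a
  assumes left_I_order: "left_I_order S Q"
    and zero: "is_zero Q z"
begin

lemma zero_closed: "z \<in> carrier Q"
  and zero_mult: "x \<in> carrier Q \<Longrightarrow> z \<otimes> x = z"
  and mult_zero: "x \<in> carrier Q \<Longrightarrow> x \<otimes> z = z"
  using zero by (auto simp: is_zero_def)

lemma is_zero_iff: "is_zero Q y \<longleftrightarrow> y = z"
  using zero unfolding is_zero_def by metis

lemma inverse_zero: "z\<^sup>\<dagger> = z"
  by (rule inverse_eqI) (simp_all add: zero_closed zero_mult)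

lemma inverse_eq_zero_iff: "x \<in> carrier Q \<Longrightarrow> x\<^sup>\<dagger> = z \<longleftrightarrow> x = z"
  using inverse_inverse inverse_zero by metis

text \<open>The nonzero idempotent \<open>e \<otimes> f\<close> lies below both \<open>e\<close> and
  \<open>f\<close>, so primitivity makes it equal to each.\<close>

lemma idempotents_eq:
  assumes "e \<in> idempotents Q" "f \<in> idempotents Q" "e \<otimes> f \<noteq> z"
  shows "e = f"
proof -
  have e: "e \<in> carrier Q" "e \<otimes> e = e" and f: "f \<in> carrier Q" "f \<otimes> f = f"
    using assms by (auto simp: idempotents_def)
  have nz: "e \<noteq> z" "f \<noteq> z" using assms(3) e f zero_mult mult_zero by auto
  have comm: "f \<otimes> e = e \<otimes> f" using idempotents_commute assms by simp
  have "idem_le Q (e \<otimes> f) e" "idem_le Q (e \<otimes> f) f"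
    unfolding idem_le_def using e f comm by (metis mult_assoc)+
  then have "e \<otimes> f = e" "e \<otimes> f = f"
    using primitive[OF assms(1)] primitive[OF assms(2)] idempotents_mult[OF assms(1,2)] nz assms(3)
    by (auto simp: primitive_idempotent_def is_zero_iff)
  then show ?thesis by simp
qed

lemma mult_nonzero_iff:
  assumes "x \<in> carrier Q" "y \<in> carrier Q"
  shows "x \<otimes> y \<noteq> z \<longleftrightarrow> x \<noteq> z \<and> y \<noteq> z \<and> x\<^sup>\<dagger> \<otimes> x = y \<otimes> y\<^sup>\<dagger>"
proof
  assume nz: "x \<otimes> y \<noteq> z"
  \<comment> \<open>Expanding both factors exposes a product of two idempotents that cannot vanish,
    so \<open>idempotents_eq\<close> applies to it.\<close>
  have "x \<otimes> y = x \<otimes> (((x\<^sup>\<dagger> \<otimes> x) \<otimes> (y \<otimes> y\<^sup>\<dagger>)) \<otimes> y)"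
    using assms by (simp add: inverse_simps)
  then have "(x\<^sup>\<dagger> \<otimes> x) \<otimes> (y \<otimes> y\<^sup>\<dagger>) \<noteq> z"
    using nz assms by (metis zero_mult mult_zero)
  then show "x \<noteq> z \<and> y \<noteq> z \<and> x\<^sup>\<dagger> \<otimes> x = y \<otimes> y\<^sup>\<dagger>"
    using nz assms zero_mult mult_zero
    by (blast intro: idempotents_eq mult_inverse_idempotent inverse_mult_idempotent)
next
  assume *: "x \<noteq> z \<and> y \<noteq> z \<and> x\<^sup>\<dagger> \<otimes> x = y \<otimes> y\<^sup>\<dagger>"
  \<comment> \<open>As \<open>x\<close> is recovered from \<open>x \<otimes> y\<close>, a zero
    product would force \<open>x\<close> to be zero.\<close>
  then have "x = x \<otimes> y \<otimes> y\<^sup>\<dagger>"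
    using assms mult_inverse_mult by (metis closed mult_assoc)
  then show "x \<otimes> y \<noteq> z" using * assms by (metis closed zero_mult)
qed

lemma inverse_mult_cancel:
  assumes "x \<in> carrier Q" "y \<in> carrier Q" "x \<otimes> y \<noteq> z"
  shows "x\<^sup>\<dagger> \<otimes> (x \<otimes> y) = y"
proof -
  have "x\<^sup>\<dagger> \<otimes> (x \<otimes> y) = (x\<^sup>\<dagger> \<otimes> x) \<otimes> y" using assms by (simp add: mult_assoc closed)
  also have "\<dots> = (y \<otimes> y\<^sup>\<dagger>) \<otimes> y" using assms mult_nonzero_iff by simp
  also have "\<dots> = y" using assms by (simp add: inverse_simps)
  finally show ?thesis .
qed

section \<open>Quotients of elements of a left I-order, described inside \<open>S\<close>\<close>

lemma S_closed: "a \<in> S \<Longrightarrow> a \<in> carrier Q"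
  and S_mult: "\<lbrakk>a \<in> S; b \<in> S\<rbrakk> \<Longrightarrow> a \<otimes> b \<in> S"
  using left_I_order by (auto simp: left_I_order_def subsemigroup_def)

lemma quotientE:
  assumes "q \<in> carrier Q"
  obtains a b where "a \<in> S" "b \<in> S" "q = a\<^sup>\<dagger> \<otimes> b"
  using left_I_order assms by (auto simp: left_I_order_def)

lemma quotient_nonzero:
  assumes "a \<in> carrier Q" "b \<in> carrier Q"
  shows "a\<^sup>\<dagger> \<otimes> b \<noteq> z \<longleftrightarrow> a \<noteq> z \<and> b \<noteq> z \<and> a \<otimes> a\<^sup>\<dagger> = b \<otimes> b\<^sup>\<dagger>"
  using assms by (simp add: mult_nonzero_iff closed inverse_inverse inverse_eq_zero_iff)

text \<open>If \<open>S\<close> missed the zero, all products in \<open>S\<close> would be nonzero, so \<open>S\<close> would lie in a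
  maximal subgroup and no quotient could vanish.\<close>
lemma zero_in_S: "z \<in> S"
proof (rule ccontr)
  assume nz: "z \<notin> S"
  obtain a b where ab: "a \<in> S" "b \<in> S" "z = a\<^sup>\<dagger> \<otimes> b" using quotientE zero_closed by blast
  have "a\<^sup>\<dagger> \<otimes> a = a \<otimes> a\<^sup>\<dagger>" "a\<^sup>\<dagger> \<otimes> a = b \<otimes> b\<^sup>\<dagger>"
    using nz ab mult_nonzero_iff S_closed S_mult by metis+
  then have "a\<^sup>\<dagger> \<otimes> b \<noteq> z" using nz ab(1,2) S_closed by (metis quotient_nonzero)
  with ab show False by simp
qed

text \<open>The denominator works: if \<open>a = x^-1 y\<close> is nonzero, then
  \<open>x x^-1 = y y^-1\<close>, so \<open>x a = y\<close>, which is nonzero.\<close>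

lemma mult_S_nonzeroE:
  assumes "a \<in> carrier Q" "a \<noteq> z"
  obtains x where "x \<in> S" "x \<otimes> a \<noteq> z"
proof -
  obtain x y where xy: "x \<in> S" "y \<in> S" "a = x\<^sup>\<dagger> \<otimes> y" using quotientE assms by blast
  then have nz: "x \<noteq> z" "y \<noteq> z" "x \<otimes> x\<^sup>\<dagger> = y \<otimes> y\<^sup>\<dagger>"
    using assms quotient_nonzero S_closed by auto
  then have "x \<otimes> a = y"
    using xy S_closed by (metis closed mult_assoc mult_inverse_mult)
  then show ?thesis using that xy nz by blast
qed

text \<open>A common \<open>x\<close> links the two idempotents: nonzero \<open>x a\<close> and
  \<open>x b\<close> give \<open>a a^-1 = x^-1 x = b b^-1\<close>. The criterion involves only
  products in \<open>S\<close>, so an isomorphism can transport it.\<close>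

lemma quotient_nonzero_iff:
  assumes "a \<in> S" "b \<in> S"
  shows "a\<^sup>\<dagger> \<otimes> b \<noteq> z \<longleftrightarrow> (\<exists>x\<in>S. x \<otimes> a \<noteq> z \<and> x \<otimes> b \<noteq> z)"
proof
  assume "a\<^sup>\<dagger> \<otimes> b \<noteq> z"
  then have *: "a \<noteq> z" "b \<noteq> z" "a \<otimes> a\<^sup>\<dagger> = b \<otimes> b\<^sup>\<dagger>"
    using quotient_nonzero assms S_closed by auto
  then obtain x where "x \<in> S" "x \<otimes> a \<noteq> z" using mult_S_nonzeroE assms S_closed by blast
  then show "\<exists>x\<in>S. x \<otimes> a \<noteq> z \<and> x \<otimes> b \<noteq> z"
    using * assms by (auto simp: mult_nonzero_iff S_closed)
next
  assume "\<exists>x\<in>S. x \<otimes> a \<noteq> z \<and> x \<otimes> b \<noteq> z"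
  then show "a\<^sup>\<dagger> \<otimes> b \<noteq> z"
    using assms S_closed mult_nonzero_iff quotient_nonzero by metis
qed

text \<open>A common left multiple in the style of the Ore condition: writing \<open>b c^-1\<close>
  as a quotient \<open>x^-1 y\<close> supplies the multipliers.\<close>

lemma mult_inverse_nonzero_iff:
  assumes "b \<in> carrier Q" "c \<in> carrier Q"
  shows "b \<otimes> c\<^sup>\<dagger> \<noteq> z \<longleftrightarrow> (\<exists>x\<in>S. \<exists>y\<in>S. x \<otimes> b = y \<otimes> c \<and> y \<otimes> c \<noteq> z)"
proof
  assume nz: "b \<otimes> c\<^sup>\<dagger> \<noteq> z"
  obtain x y where xy: "x \<in> S" "y \<in> S" "b \<otimes> c\<^sup>\<dagger> = x\<^sup>\<dagger> \<otimes> y" using quotientE assms closed by metis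
  have x: "x \<in> carrier Q" and y: "y \<in> carrier Q" using xy S_closed by auto
  have eq1: "b \<noteq> z" "c \<noteq> z" "b\<^sup>\<dagger> \<otimes> b = c\<^sup>\<dagger> \<otimes> c"
    using nz assms by (auto simp: mult_nonzero_iff closed inverse_inverse inverse_eq_zero_iff)
  have eq2: "x \<noteq> z" "y \<noteq> z" "x \<otimes> x\<^sup>\<dagger> = y \<otimes> y\<^sup>\<dagger>"
    using nz xy(3) quotient_nonzero x y by auto
  have xb: "x \<otimes> b = y \<otimes> c"
  proof -
    have "x \<otimes> b = x \<otimes> (b \<otimes> (c\<^sup>\<dagger> \<otimes> c))"
      using eq1 assms by (metis mult_inverse_mult)
    also have "\<dots> = x \<otimes> ((b \<otimes> c\<^sup>\<dagger>) \<otimes> c)" using assms by (simp add: mult_assoc closed)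
    also have "\<dots> = ((x \<otimes> x\<^sup>\<dagger>) \<otimes> y) \<otimes> c" using assms x y xy by (simp add: mult_assoc closed)
    also have "\<dots> = y \<otimes> c" using eq2 assms x y by (simp add: inverse_simps)
    finally show ?thesis .
  qed
  have "y \<otimes> c \<noteq> z"
  proof
    assume "y \<otimes> c = z"
    then have "x \<otimes> (b \<otimes> c\<^sup>\<dagger>) = z"
      using xb assms x y by (metis closed mult_assoc zero_mult)
    moreover have "x \<otimes> (b \<otimes> c\<^sup>\<dagger>) = y"
      using xy(3) eq2 x y by (metis closed mult_assoc mult_inverse_mult)
    ultimately show False using eq2 by simp
  qed
  then show "\<exists>x\<in>S. \<exists>y\<in>S. x \<otimes> b = y \<otimes> c \<and> y \<otimes> c \<noteq> z" using xy xb by blast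
next
  assume "\<exists>x\<in>S. \<exists>y\<in>S. x \<otimes> b = y \<otimes> c \<and> y \<otimes> c \<noteq> z"
  then obtain x y where xy: "x \<in> S" "y \<in> S" "x \<otimes> b = y \<otimes> c" "y \<otimes> c \<noteq> z" by blast
  have x: "x \<in> carrier Q" and y: "y \<in> carrier Q" using xy S_closed by auto
  \<comment> \<open>Since \<open>y c\<close> is nonzero, \<open>c c^-1 = y^-1 y\<close>; hence
    \<open>x (b c^-1) = y c c^-1 = y\<close> is nonzero.\<close>
  have "y \<otimes> c \<otimes> c\<^sup>\<dagger> = y" "y \<noteq> z"
    using xy(4) y assms mult_nonzero_iff mult_inverse_mult by (metis closed mult_assoc)+
  then have "x \<otimes> (b \<otimes> c\<^sup>\<dagger>) \<noteq> z"
    using xy x y assms by (metis closed mult_assoc)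
  then show "b \<otimes> c\<^sup>\<dagger> \<noteq> z" using x mult_zero by metis
qed

text \<open>The middle factor \<open>x^-1 x\<close> equals \<open>a a^-1\<close> and is absorbed by
  \<open>a^-1\<close>; \<open>x b\<close> may be zero.\<close>

lemma quotient_cancel:
  assumes "a \<in> carrier Q" "b \<in> carrier Q" "x \<in> carrier Q" "x \<otimes> a \<noteq> z"
  shows "(x \<otimes> a)\<^sup>\<dagger> \<otimes> (x \<otimes> b) = a\<^sup>\<dagger> \<otimes> b"
proof -
  have "x\<^sup>\<dagger> \<otimes> x = a \<otimes> a\<^sup>\<dagger>" using assms mult_nonzero_iff by blast
  then have "(x \<otimes> a)\<^sup>\<dagger> \<otimes> (x \<otimes> b) = a\<^sup>\<dagger> \<otimes> ((a \<otimes> a\<^sup>\<dagger>) \<otimes> b)"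
    using assms by (metis inverse_mult closed mult_assoc)
  then show ?thesis using assms by (simp add: inverse_simps)
qed

text \<open>Forwards, a common left multiple of \<open>a\<close> and \<open>c\<close> times the
  shared quotient gives \<open>x b = y d\<close>. Backwards, \<open>x\<close> and \<open>y\<close>
  cancel by \<open>quotient_cancel\<close>.\<close>

lemma quotient_eq_iff:
  assumes "a \<in> S" "b \<in> S" "c \<in> S" "d \<in> S" "a\<^sup>\<dagger> \<otimes> b \<noteq> z" "c\<^sup>\<dagger> \<otimes> d \<noteq> z"
  shows "a\<^sup>\<dagger> \<otimes> b = c\<^sup>\<dagger> \<otimes> d \<longleftrightarrow>
    (\<exists>x\<in>S. \<exists>y\<in>S. x \<otimes> a = y \<otimes> c \<and> y \<otimes> c \<noteq> z \<and> x \<otimes> b = y \<otimes> d)"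
proof
  note cl = assms(1-4)[THEN S_closed]
  have ab: "a \<noteq> z" "a \<otimes> a\<^sup>\<dagger> = b \<otimes> b\<^sup>\<dagger>" and cd: "c \<noteq> z" "c \<otimes> c\<^sup>\<dagger> = d \<otimes> d\<^sup>\<dagger>"
    using assms(5,6) cl quotient_nonzero by auto
  have b: "a \<otimes> (a\<^sup>\<dagger> \<otimes> b) = b" and d: "c \<otimes> (c\<^sup>\<dagger> \<otimes> d) = d"
    using ab cd cl by (metis closed mult_assoc mult_inverse_mult)+
  assume eq: "a\<^sup>\<dagger> \<otimes> b = c\<^sup>\<dagger> \<otimes> d"
  \<comment> \<open>Otherwise \<open>b = a a^-1 b = a c^-1 d\<close> would vanish.\<close>
  have "a \<otimes> c\<^sup>\<dagger> \<noteq> z"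
  proof
    assume "a \<otimes> c\<^sup>\<dagger> = z"
    then have "b = z" using b eq cl zero_mult by (metis closed mult_assoc)
    then show False using assms(5) cl mult_zero closed by auto
  qed
  then obtain x y where xy: "x \<in> S" "y \<in> S" "x \<otimes> a = y \<otimes> c" "y \<otimes> c \<noteq> z"
    using mult_inverse_nonzero_iff cl by blast
  have "x \<otimes> b = (x \<otimes> a) \<otimes> (a\<^sup>\<dagger> \<otimes> b)"
    using b cl xy(1) S_closed by (metis closed mult_assoc)
  also have "\<dots> = y \<otimes> d"
    using d eq cl xy S_closed by (metis closed mult_assoc)
  finally show "\<exists>x\<in>S. \<exists>y\<in>S. x \<otimes> a = y \<otimes> c \<and> y \<otimes> c \<noteq> z \<and> x \<otimes> b = y \<otimes> d"
    using xy by blast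
next
  assume "\<exists>x\<in>S. \<exists>y\<in>S. x \<otimes> a = y \<otimes> c \<and> y \<otimes> c \<noteq> z \<and> x \<otimes> b = y \<otimes> d"
  then show "a\<^sup>\<dagger> \<otimes> b = c\<^sup>\<dagger> \<otimes> d"
    using quotient_cancel assms(1-4) S_closed by metis
qed

text \<open>The inner factor turns around:
  \<open>b c^-1 = x^-1 x b c^-1 = x^-1 y c c^-1 = x^-1 y\<close>.\<close>

lemma quotient_mult:
  assumes "a \<in> carrier Q" "b \<in> carrier Q" "c \<in> carrier Q" "d \<in> carrier Q"
    and "x \<in> carrier Q" "y \<in> carrier Q" "x \<otimes> b = y \<otimes> c" "y \<otimes> c \<noteq> z"
  shows "(a\<^sup>\<dagger> \<otimes> b) \<otimes> (c\<^sup>\<dagger> \<otimes> d) = (x \<otimes> a)\<^sup>\<dagger> \<otimes> (y \<otimes> d)"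
proof -
  have x: "x\<^sup>\<dagger> \<otimes> x = b \<otimes> b\<^sup>\<dagger>" and y: "y\<^sup>\<dagger> \<otimes> y = c \<otimes> c\<^sup>\<dagger>"
    using assms mult_nonzero_iff by metis+
  have "b \<otimes> c\<^sup>\<dagger> = x\<^sup>\<dagger> \<otimes> (x \<otimes> b) \<otimes> c\<^sup>\<dagger>"
    using x assms(1-6) by (metis closed mult_assoc mult_inverse_mult)
  also have "\<dots> = x\<^sup>\<dagger> \<otimes> (y \<otimes> (c \<otimes> c\<^sup>\<dagger>))"
    using assms(1-6) by (simp add: assms(7) mult_assoc closed)
  also have "\<dots> = x\<^sup>\<dagger> \<otimes> y"
    using assms(1-6) by (simp add: y[symmetric] mult_inverse_mult)
  finally have "b \<otimes> c\<^sup>\<dagger> = x\<^sup>\<dagger> \<otimes> y" .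
  then have "a\<^sup>\<dagger> \<otimes> ((b \<otimes> c\<^sup>\<dagger>) \<otimes> d) = a\<^sup>\<dagger> \<otimes> ((x\<^sup>\<dagger> \<otimes> y) \<otimes> d)" by simp
  then show ?thesis using assms(1-6) by (simp add: inverse_mult mult_assoc closed)
qed

text \<open>Multiplying the product by \<open>a\<close> on the left and \<open>d^-1\<close> on the
  right recovers \<open>b c^-1\<close>, so the two vanish together.\<close>

lemma quotient_mult_nonzero_iff:
  assumes "a \<in> S" "b \<in> S" "c \<in> S" "d \<in> S" "a\<^sup>\<dagger> \<otimes> b \<noteq> z" "c\<^sup>\<dagger> \<otimes> d \<noteq> z"
  shows "(a\<^sup>\<dagger> \<otimes> b) \<otimes> (c\<^sup>\<dagger> \<otimes> d) \<noteq> z \<longleftrightarrow> (\<exists>x\<in>S. \<exists>y\<in>S. x \<otimes> b = y \<otimes> c \<and> y \<otimes> c \<noteq> z)"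
proof -
  note cl = assms(1-4)[THEN S_closed]
  have ab: "a \<otimes> a\<^sup>\<dagger> = b \<otimes> b\<^sup>\<dagger>" and cd: "c \<otimes> c\<^sup>\<dagger> = d \<otimes> d\<^sup>\<dagger>"
    using assms(5,6) cl quotient_nonzero by auto
  have b: "a \<otimes> (a\<^sup>\<dagger> \<otimes> b) = b" and d: "(c\<^sup>\<dagger> \<otimes> d) \<otimes> d\<^sup>\<dagger> = c\<^sup>\<dagger>"
    using ab cd cl by (metis closed mult_assoc mult_inverse_mult inverse_mult_inverse)+
  have "a \<otimes> ((a\<^sup>\<dagger> \<otimes> b) \<otimes> (c\<^sup>\<dagger> \<otimes> d)) \<otimes> d\<^sup>\<dagger> = (a \<otimes> (a\<^sup>\<dagger> \<otimes> b)) \<otimes> ((c\<^sup>\<dagger> \<otimes> d) \<otimes> d\<^sup>\<dagger>)"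
    using cl by (simp add: mult_assoc closed)
  then have 1: "a \<otimes> ((a\<^sup>\<dagger> \<otimes> b) \<otimes> (c\<^sup>\<dagger> \<otimes> d)) \<otimes> d\<^sup>\<dagger> = b \<otimes> c\<^sup>\<dagger>" by (simp add: b d)
  have 2: "(a\<^sup>\<dagger> \<otimes> b) \<otimes> (c\<^sup>\<dagger> \<otimes> d) = a\<^sup>\<dagger> \<otimes> (b \<otimes> c\<^sup>\<dagger>) \<otimes> d"
    using cl by (simp add: mult_assoc closed)
  have "(a\<^sup>\<dagger> \<otimes> b) \<otimes> (c\<^sup>\<dagger> \<otimes> d) \<noteq> z \<longleftrightarrow> b \<otimes> c\<^sup>\<dagger> \<noteq> z"
    using 1 2 cl closed zero_mult mult_zero by metis
  then show ?thesis using mult_inverse_nonzero_iff cl by simp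
qed

end

section \<open>Transport of the criteria along the isomorphism \<open>\<phi>\<close>\<close>

locale primitive_left_I_order_iso =
  Q: primitive_left_I_order Q S z + P: primitive_left_I_order P T w
  for Q :: "('a, 'c) monoid_scheme" and S z and P :: "('b, 'd) monoid_scheme" and T w +
  fixes \<phi> :: "'a \<Rightarrow> 'b"
  assumes bij: "bij_betw \<phi> S T"
    and hom: "\<lbrakk>a \<in> S; b \<in> S\<rbrakk> \<Longrightarrow> \<phi> (a \<otimes>\<^bsub>Q\<^esub> b) = \<phi> a \<otimes>\<^bsub>P\<^esub> \<phi> b"
begin

lemma image: "\<phi> ` S = T"
  using bij by (rule bij_betw_imp_surj_on)

lemma map_closed: "a \<in> S \<Longrightarrow> \<phi> a \<in> T"
  using image by blast

lemma map_eq_iff: "\<lbrakk>a \<in> S; b \<in> S\<rbrakk> \<Longrightarrow> \<phi> a = \<phi> b \<longleftrightarrow> a = b"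
  using bij by (auto simp: bij_betw_def inj_on_def)

lemma ex_image_iff: "(\<exists>u\<in>T. R u) \<longleftrightarrow> (\<exists>x\<in>S. R (\<phi> x))"
  using image by blast

text \<open>As \<open>w\<close> lies in \<open>T\<close>, it has a preimage \<open>s\<close>, and
  \<open>z \<otimes> s = z\<close> makes \<open>\<phi> z\<close> a multiple of
  \<open>w\<close>.\<close>

lemma map_zero: "\<phi> z = w"
proof -
  obtain s where s: "s \<in> S" "\<phi> s = w" using image P.zero_in_S by (metis imageE)
  have "\<phi> z = \<phi> (z \<otimes>\<^bsub>Q\<^esub> s)" using s Q.zero_mult Q.S_closed by simp
  also have "\<dots> = \<phi> z \<otimes>\<^bsub>P\<^esub> w" using s hom Q.zero_in_S by simp
  also have "\<dots> = w" using P.mult_zero P.S_closed map_closed Q.zero_in_S by blast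
  finally show ?thesis .
qed

lemma map_eq_zero_iff: "a \<in> S \<Longrightarrow> \<phi> a = w \<longleftrightarrow> a = z"
  using map_eq_iff[OF _ Q.zero_in_S] map_zero by simp

text \<open>These rules rewrite a criterion for images in \<open>T\<close> into the same criterion
  in \<open>S\<close>.\<close>

lemmas transfer_simps = ex_image_iff hom[symmetric] Q.S_mult map_eq_iff map_eq_zero_iff map_closed

lemma map_quotient_zero_iff:
  assumes "a \<in> S" "b \<in> S"
  shows "sg_inv P (\<phi> a) \<otimes>\<^bsub>P\<^esub> \<phi> b = w \<longleftrightarrow> sg_inv Q a \<otimes>\<^bsub>Q\<^esub> b = z"
  using Q.quotient_nonzero_iff[OF assms] P.quotient_nonzero_iff[of "\<phi> a" "\<phi> b"] assms
  by (simp add: transfer_simps cong: bex_cong) argo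

lemma map_quotient_eq_iff:
  assumes "a \<in> S" "b \<in> S" "c \<in> S" "d \<in> S"
  shows "sg_inv P (\<phi> a) \<otimes>\<^bsub>P\<^esub> \<phi> b = sg_inv P (\<phi> c) \<otimes>\<^bsub>P\<^esub> \<phi> d
    \<longleftrightarrow> sg_inv Q a \<otimes>\<^bsub>Q\<^esub> b = sg_inv Q c \<otimes>\<^bsub>Q\<^esub> d"
proof (cases "sg_inv Q a \<otimes>\<^bsub>Q\<^esub> b = z \<or> sg_inv Q c \<otimes>\<^bsub>Q\<^esub> d = z")
  case True
  \<comment> \<open>With one quotient zero, each equality says that the other quotient is zero as
    well.\<close>
  then show ?thesis using assms map_quotient_zero_iff by metis
next
  case False
  then show ?thesis
    using Q.quotient_eq_iff[OF assms] P.quotient_eq_iff[of "\<phi> a" "\<phi> b" "\<phi> c" "\<phi> d"]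
      map_quotient_zero_iff assms
    by (simp add: transfer_simps cong: bex_cong)
qed

section \<open>The lifted map and its properties\<close>

definition lift :: "'a \<Rightarrow> 'b" where
  "lift q = (SOME p. \<exists>a\<in>S. \<exists>b\<in>S. q = sg_inv Q a \<otimes>\<^bsub>Q\<^esub> b \<and> p = sg_inv P (\<phi> a) \<otimes>\<^bsub>P\<^esub> \<phi> b)"

text \<open>The choice is immaterial: equal quotients in \<open>Q\<close> have equal images by
  \<open>map_quotient_eq_iff\<close>.\<close>

lemma lift_quotient:
  assumes "a \<in> S" "b \<in> S"
  shows "lift (sg_inv Q a \<otimes>\<^bsub>Q\<^esub> b) = sg_inv P (\<phi> a) \<otimes>\<^bsub>P\<^esub> \<phi> b"
  unfolding lift_def
proof (rule some_equality)
  fix p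
  assume "\<exists>c\<in>S. \<exists>d\<in>S. sg_inv Q a \<otimes>\<^bsub>Q\<^esub> b = sg_inv Q c \<otimes>\<^bsub>Q\<^esub> d \<and> p = sg_inv P (\<phi> c) \<otimes>\<^bsub>P\<^esub> \<phi> d"
  then show "p = sg_inv P (\<phi> a) \<otimes>\<^bsub>P\<^esub> \<phi> b"
    using assms map_quotient_eq_iff by metis
qed (use assms in blast)

lemma lift_closed: "q \<in> carrier Q \<Longrightarrow> lift q \<in> carrier P"
  using lift_quotient P.closed P.S_closed map_closed by (metis Q.quotientE)

lemma lift_eq_zero_iff: "q \<in> carrier Q \<Longrightarrow> lift q = w \<longleftrightarrow> q = z"
  using lift_quotient map_quotient_zero_iff by (metis Q.quotientE)

text \<open>Vanishing of the product is governed by the same condition on both sides. For a nonzero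
  product, \<open>\<phi>\<close> carries the multipliers \<open>x\<close>, \<open>y\<close> to
  multipliers in \<open>T\<close>, so \<open>quotient_mult\<close> computes both products
  alike.\<close>

lemma lift_mult:
  assumes q: "q \<in> carrier Q" and r: "r \<in> carrier Q"
  shows "lift (q \<otimes>\<^bsub>Q\<^esub> r) = lift q \<otimes>\<^bsub>P\<^esub> lift r"
proof (cases "q = z \<or> r = z")
  case True
  have "lift z = w" using lift_eq_zero_iff Q.zero_closed by blast
  then show ?thesis
    using True q r lift_closed Q.zero_mult Q.mult_zero P.zero_mult P.mult_zero by auto
next
  case False
  obtain a b where ab: "a \<in> S" "b \<in> S" "q = sg_inv Q a \<otimes>\<^bsub>Q\<^esub> b" using Q.quotientE q by blast
  obtain c d where cd: "c \<in> S" "d \<in> S" "r = sg_inv Q c \<otimes>\<^bsub>Q\<^esub> d" using Q.quotientE r by blast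
  have nz: "sg_inv Q a \<otimes>\<^bsub>Q\<^esub> b \<noteq> z" "sg_inv Q c \<otimes>\<^bsub>Q\<^esub> d \<noteq> z" using False ab cd by auto
  have lq: "lift q = sg_inv P (\<phi> a) \<otimes>\<^bsub>P\<^esub> \<phi> b" and lr: "lift r = sg_inv P (\<phi> c) \<otimes>\<^bsub>P\<^esub> \<phi> d"
    using lift_quotient ab cd by auto
  have Qnz: "q \<otimes>\<^bsub>Q\<^esub> r \<noteq> z \<longleftrightarrow> (\<exists>x\<in>S. \<exists>y\<in>S. x \<otimes>\<^bsub>Q\<^esub> b = y \<otimes>\<^bsub>Q\<^esub> c \<and> y \<otimes>\<^bsub>Q\<^esub> c \<noteq> z)"
    using Q.quotient_mult_nonzero_iff[OF ab(1,2) cd(1,2) nz] ab(3) cd(3) by simp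
  show ?thesis
  proof (cases "q \<otimes>\<^bsub>Q\<^esub> r = z")
    case True
    have "lift q \<otimes>\<^bsub>P\<^esub> lift r \<noteq> w \<longleftrightarrow> q \<otimes>\<^bsub>Q\<^esub> r \<noteq> z"
      using P.quotient_mult_nonzero_iff[of "\<phi> a" "\<phi> b" "\<phi> c" "\<phi> d"] Qnz ab(1,2) cd(1,2) nz
        map_quotient_zero_iff
      by (simp add: lq lr transfer_simps cong: bex_cong)
    then show ?thesis using True lift_eq_zero_iff Q.zero_closed by auto
  next
    case False
    then obtain x y where xy: "x \<in> S" "y \<in> S" "x \<otimes>\<^bsub>Q\<^esub> b = y \<otimes>\<^bsub>Q\<^esub> c" "y \<otimes>\<^bsub>Q\<^esub> c \<noteq> z"
      using Qnz by blast
    have "q \<otimes>\<^bsub>Q\<^esub> r = sg_inv Q (x \<otimes>\<^bsub>Q\<^esub> a) \<otimes>\<^bsub>Q\<^esub> (y \<otimes>\<^bsub>Q\<^esub> d)"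
      using Q.quotient_mult[of a b c d x y] ab cd xy Q.S_closed by simp
    then have "lift (q \<otimes>\<^bsub>Q\<^esub> r) = sg_inv P (\<phi> x \<otimes>\<^bsub>P\<^esub> \<phi> a) \<otimes>\<^bsub>P\<^esub> (\<phi> y \<otimes>\<^bsub>P\<^esub> \<phi> d)"
      using lift_quotient ab cd xy Q.S_mult hom by simp
    also have "\<dots> = lift q \<otimes>\<^bsub>P\<^esub> lift r"
      unfolding lq lr
    proof (rule P.quotient_mult[symmetric])
      show "\<phi> x \<otimes>\<^bsub>P\<^esub> \<phi> b = \<phi> y \<otimes>\<^bsub>P\<^esub> \<phi> c" using ab cd xy by (metis hom)
      show "\<phi> y \<otimes>\<^bsub>P\<^esub> \<phi> c \<noteq> w" using cd xy by (simp add: transfer_simps)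
    qed (use ab cd xy map_closed P.S_closed in auto)
    finally show ?thesis .
  qed
qed

text \<open>The converse half of \<open>map_quotient_eq_iff\<close> gives injectivity; surjectivity
  comes from pulling numerator and denominator in \<open>T\<close> back to \<open>S\<close>.\<close>

lemma lift_iso: "lift \<in> iso Q P"
proof -
  have "inj_on lift (carrier Q)"
  proof (rule inj_onI)
    fix q r assume "q \<in> carrier Q" "r \<in> carrier Q" "lift q = lift r"
    then show "q = r"
      using lift_quotient map_quotient_eq_iff by (metis Q.quotientE)
  qed
  moreover have "p \<in> lift ` carrier Q" if p: "p \<in> carrier P" for p
  proof -
    obtain u v where "u \<in> T" "v \<in> T" and p_eq: "p = sg_inv P u \<otimes>\<^bsub>P\<^esub> v"
      using P.quotientE p by blast
    then obtain a b where ab: "a \<in> S" "b \<in> S" "u = \<phi> a" "v = \<phi> b" using image by blast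
    then have "lift (sg_inv Q a \<otimes>\<^bsub>Q\<^esub> b) = p" using lift_quotient p_eq by simp
    then show ?thesis using ab Q.closed Q.S_closed by blast
  qed
  ultimately show ?thesis
    using lift_closed lift_mult by (auto simp: iso_def hom_def bij_betw_def)
qed

text \<open>Multiplying \<open>s\<close> by some \<open>x \<in> S\<close> with \<open>x s \<noteq> 0\<close> exhibits it as the quotient
  \<open>x\<^sup>-\<^sup>1 (x s)\<close>, and the same identity holds in \<open>P\<close>.\<close>
lemma lift_extends:
  assumes s: "s \<in> S"
  shows "lift s = \<phi> s"
proof (cases "s = z")
  case True
  then show ?thesis using lift_eq_zero_iff Q.zero_closed map_zero by auto
next
  case False
  then obtain x where x: "x \<in> S" "x \<otimes>\<^bsub>Q\<^esub> s \<noteq> z" using Q.mult_S_nonzeroE s Q.S_closed by blast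
  then have "\<phi> x \<otimes>\<^bsub>P\<^esub> \<phi> s \<noteq> w" using s by (simp add: transfer_simps)
  then have Ps: "sg_inv P (\<phi> x) \<otimes>\<^bsub>P\<^esub> (\<phi> x \<otimes>\<^bsub>P\<^esub> \<phi> s) = \<phi> s"
    using P.inverse_mult_cancel s x(1) map_closed P.S_closed by simp
  have "sg_inv Q x \<otimes>\<^bsub>Q\<^esub> (x \<otimes>\<^bsub>Q\<^esub> s) = s"
    using Q.inverse_mult_cancel s x Q.S_closed by simp
  then have "lift s = sg_inv P (\<phi> x) \<otimes>\<^bsub>P\<^esub> \<phi> (x \<otimes>\<^bsub>Q\<^esub> s)"
    using lift_quotient[of x "x \<otimes>\<^bsub>Q\<^esub> s"] s x Q.S_mult by simp
  then show ?thesis using Ps s x hom by simp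
qed

end

theorem theorem4p3:
  fixes Q :: "('a, 'c) monoid_scheme" and P :: "('b, 'd) monoid_scheme"
    and S :: "'a set" and T :: "'b set" and \<phi> :: "'a \<Rightarrow> 'b"
  assumes "primitive_inverse_semigroup Q" and "left_I_order S Q"
    and "primitive_inverse_semigroup P" and "left_I_order T P"
    and "\<phi> \<in> iso (Q\<lparr>carrier := S\<rparr>) (P\<lparr>carrier := T\<rparr>)"
  shows "\<exists>\<psi> \<in> iso Q P. \<forall>s\<in>S. \<psi> s = \<phi> s"
proof -
  obtain z w where "is_zero Q z" "is_zero P w"
    using assms(1,3) primitive_inverse_semigroup.ex_zero by metis
  then interpret primitive_left_I_order_iso Q S z P T w \<phi>
    using assms
    by (intro primitive_left_I_order_iso.intro primitive_left_I_order.intro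
        primitive_left_I_order_axioms.intro primitive_left_I_order_iso_axioms.intro)
      (auto simp: iso_def hom_def)
  show ?thesis using lift_iso lift_extends by blast
qed

end
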